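(* Let $K$ be a field, $S=K[x_1,\ldots,x_n]$, let $I\subset S$ be a monomial ideal, and let $I=\bigcap_{j=1}^sQ_j$ be its unique irredundant presentation as an intersection of irreducible monomial ideals. Let $0\le r\le n$ and $Y=\{x_1,\ldots,x_r\}$. For each $\tau\subset[s]=\{1,\ldots,s\}$ let $I_\tau$ be the $\mathbb{Z}^n$-graded $K$-vector space spanned by the set of monomials of the form $w=uv$, where $u$ and $v$ are monomials with $$u\in K[x_1,\ldots,x_r]\quad\text{and}\quad u\in\bigcap_{j\notin\tau}Q_j\setminus\sum_{j\in\tau}Q_j,$$ $$v\in K[x_{r+1},\ldots,x_n]\quad\text{and}\quad v\in\bigcap_{j\in\tau}Q_j.$$ Then $I$ has a decomposition $$\mathcal{D}_Y:\quad I=\bigoplus_{\tau\subset[s]}I_\tau$$ as a direct sum of $\mathbb{Z}^n$-graded $K$-subspaces of $I$.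
   Context: An irreducible monomial ideal is one generated by powers of a subset of the variables, $(x_{i_1}^{a_1},\ldots,x_{i_k}^{a_k})$ with all $a_j>0$; every monomial ideal is in a unique way an irredundant intersection of such ideals. An empty intersection of ideals is $S$, and an empty sum of ideals is $(0)$. *)

theory Defs
  imports
    Complex_Main
    "HOL-Algebra.Ideal"
    "HOL-Library.Poly_Mapping"
    "HOL-Library.Set_Algebras"
begin

text \<open>
  Exponent vectors are finitely supported functions \<open>nat \<Rightarrow>\<^sub>0 nat\<close>, and a polynomial is a finitely
  supported assignment of coefficients to exponent vectors. The ambient type has countably many
  variables; \<open>polys V\<close> is the subring \<open>K[x\<^sub>i | i \<in> V]\<close>, so that \<open>polys {1..n}\<close> is \<open>K[x\<^sub>1, \<dots>, x\<^sub>n]\<close>.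
\<close>

type_synonym 'k mpoly = "(nat \<Rightarrow>\<^sub>0 nat) \<Rightarrow>\<^sub>0 'k"

definition polys :: "nat set \<Rightarrow> 'k::field mpoly set" where
  "polys V = {p. \<forall>m\<in>Poly_Mapping.keys p. Poly_Mapping.keys m \<subseteq> V}"

definition poly_ring :: "nat set \<Rightarrow> 'k::field mpoly ring" where
  "poly_ring V = \<lparr>carrier = polys V, monoid.mult = (*), one = 1, zero = 0, add = (+)\<rparr>"

definition monomials :: "'k::field mpoly set" where
  "monomials = {Poly_Mapping.single m 1 | m. True}"

definition var :: "nat \<Rightarrow> 'k::field mpoly" where
  "var i = Poly_Mapping.single (Poly_Mapping.single i 1) 1"

definition scalar_mult :: "'k::field \<Rightarrow> 'k mpoly \<Rightarrow> 'k mpoly" where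
  "scalar_mult c p = Poly_Mapping.map ((*) c) p"


subsection \<open>Ring and vector space structure\<close>

lemma polys_minus: "p \<in> polys V \<Longrightarrow> - p \<in> polys V"
  by (simp add: polys_def)

lemma polys_add: "p \<in> polys V \<Longrightarrow> q \<in> polys V \<Longrightarrow> p + q \<in> polys V"
  using Poly_Mapping.keys_add[of p q] by (auto simp: polys_def)

lemma polys_mult:
  assumes "p \<in> polys V" "q \<in> polys V"
  shows "p * q \<in> polys V"
proof -
  have "Poly_Mapping.keys m \<subseteq> V" if m: "m \<in> Poly_Mapping.keys (p * q)" for m
  proof -
    obtain a b where "m = a + b" "a \<in> Poly_Mapping.keys p" "b \<in> Poly_Mapping.keys q"
      using keys_mult[of p q] m by auto
    then show ?thesis
      using Poly_Mapping.keys_add[of a b] assms by (auto simp: polys_def)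
  qed
  then show ?thesis by (simp add: polys_def)
qed

lemma cring_poly_ring: "cring (poly_ring V :: 'k::field mpoly ring)"
proof (rule cringI)
  show "abelian_group (poly_ring V :: 'k mpoly ring)"
  proof (rule abelian_groupI)
    fix p :: "'k mpoly"
    assume "p \<in> carrier (poly_ring V)"
    then show "\<exists>q\<in>carrier (poly_ring V). q \<oplus>\<^bsub>poly_ring V\<^esub> p = \<zero>\<^bsub>poly_ring V\<^esub>"
      by (intro bexI[of _ "- p"]) (auto simp: poly_ring_def intro: polys_minus)
  qed (auto simp: poly_ring_def polys_add ac_simps, auto simp: polys_def)
  show "Group.comm_monoid (poly_ring V :: 'k mpoly ring)"
    by (rule comm_monoidI) (auto simp: poly_ring_def polys_mult ac_simps, auto simp: polys_def)
qed (auto simp: poly_ring_def distrib_right)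

global_interpretation mpoly: vector_space "scalar_mult :: 'k::field \<Rightarrow> 'k mpoly \<Rightarrow> 'k mpoly"
  by unfold_locales
    (auto simp: scalar_mult_def mult_map_scale_conv_mult distrib_left distrib_right
      single_add mult_single simp flip: mult.assoc)


subsection \<open>Monomial ideals\<close>

definition monomial_ideal :: "nat \<Rightarrow> 'k::field mpoly set \<Rightarrow> bool" where
  "monomial_ideal n I \<longleftrightarrow>
     (\<exists>M \<subseteq> monomials \<inter> polys {1..n}. I = Idl\<^bsub>poly_ring {1..n}\<^esub> M)"

text \<open>
  The subset of the variables may be empty: the zero ideal is an irreducible monomial ideal.
  Without it, the zero ideal would have no presentation as an intersection of irreducible ones.
\<close>

definition irreducible_monomial_ideal :: "nat \<Rightarrow> 'k::field mpoly set \<Rightarrow> bool" where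
  "irreducible_monomial_ideal n Q \<longleftrightarrow>
     (\<exists>V a. V \<subseteq> {1..n} \<and> (\<forall>i\<in>V. a i > (0::nat)) \<and>
        Q = Idl\<^bsub>poly_ring {1..n}\<^esub> ((\<lambda>i. var i ^ a i) ` V))"

text \<open>Intersecting with the carrier makes the empty intersection equal to \<open>K[x\<^sub>1, \<dots>, x\<^sub>n]\<close>.\<close>

definition ideal_Inter :: "nat \<Rightarrow> (nat \<Rightarrow> 'k::field mpoly set) \<Rightarrow> nat set \<Rightarrow> 'k mpoly set" where
  "ideal_Inter n Q J = polys {1..n} \<inter> (\<Inter>j\<in>J. Q j)"

definition irredundant_irreducible_presentation ::
  "nat \<Rightarrow> 'k::field mpoly set \<Rightarrow> nat \<Rightarrow> (nat \<Rightarrow> 'k mpoly set) \<Rightarrow> bool" where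
  "irredundant_irreducible_presentation n I s Q \<longleftrightarrow>
     (\<forall>j\<in>{1..s}. irreducible_monomial_ideal n (Q j)) \<and>
     I = ideal_Inter n Q {1..s} \<and>
     (\<forall>j\<in>{1..s}. ideal_Inter n Q ({1..s} - {j}) \<noteq> I)"


subsection \<open>Direct sums and the fine grading\<close>

text \<open>
  \<open>W\<close> is the internal direct sum of the subspaces \<open>V i\<close>, \<open>i \<in> A\<close>. The index set may be infinite;
  families are extended by \<open>0\<close> outside \<open>A\<close> so that their uniqueness is equality of functions.
\<close>

definition is_direct_sum ::
  "'i set \<Rightarrow> ('i \<Rightarrow> 'k::field mpoly set) \<Rightarrow> 'k mpoly set \<Rightarrow> bool" where
  "is_direct_sum A V W \<longleftrightarrow>
     mpoly.subspace W \<and>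
     (\<forall>i\<in>A. mpoly.subspace (V i) \<and> V i \<subseteq> W) \<and>
     (\<forall>w\<in>W. \<exists>!f. (\<forall>i\<in>A. f i \<in> V i) \<and> (\<forall>i. i \<notin> A \<longrightarrow> f i = 0) \<and>
        finite {i. f i \<noteq> 0} \<and> w = (\<Sum>i | f i \<noteq> 0. f i))"

text \<open>
  The component of degree \<open>a \<in> \<int>\<^sup>n\<close> of \<open>K[x\<^sub>1, \<dots>, x\<^sub>n]\<close>, i.e. \<open>K x\<^sup>a\<close>, which is \<open>0\<close> if \<open>a\<close> has a
  negative entry.
\<close>

definition graded_component :: "nat \<Rightarrow> (nat \<Rightarrow> int) \<Rightarrow> 'k::field mpoly set" where
  "graded_component n a =
     {p \<in> polys {1..n}. \<forall>m\<in>Poly_Mapping.keys p. \<forall>i\<in>{1..n}. int (Poly_Mapping.lookup m i) = a i}"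

definition graded_subspace :: "nat \<Rightarrow> 'k::field mpoly set \<Rightarrow> bool" where
  "graded_subspace n V \<longleftrightarrow>
     is_direct_sum ({1..n} \<rightarrow>\<^sub>E (UNIV :: int set)) (\<lambda>a. V \<inter> graded_component n a) V"


subsection \<open>The pieces of the decomposition\<close>

text \<open>
  \<open>sum Q \<tau>\<close> is the sum of ideals: addition of sets is elementwise, and the empty sum is \<open>{0}\<close>.
\<close>

definition piece ::
  "nat \<Rightarrow> nat \<Rightarrow> nat \<Rightarrow> (nat \<Rightarrow> 'k::field mpoly set) \<Rightarrow> nat set \<Rightarrow> 'k mpoly set" where
  "piece n r s Q \<tau> = mpoly.span {u * v | u v.
     u \<in> monomials \<and> v \<in> monomials \<and>
     u \<in> polys {1..r} \<and> u \<in> ideal_Inter n Q ({1..s} - \<tau>) - sum Q \<tau> \<and>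
     v \<in> polys {r+1..n} \<and> v \<in> ideal_Inter n Q \<tau>}"

end

theory Submission
  imports Defs "HOL-Library.Disjoint_Sets"
begin

text \<open>
  Everything in sight is spanned by monomials, so the statement is one about sets of exponent
  vectors: a partition of such a set gives a direct sum decomposition of the space that its
  monomials span (\<open>is_direct_sum_monomial_span\<close>). Applied to the partition by degree, this shows
  that a space spanned by monomials is graded; what remains is to show that the monomials of the
  pieces partition the monomials of \<open>I\<close>.

  An ideal generated by powers of variables contains a monomial \<open>w\<close> if and only if, for one of
  these variables, the exponent in \<open>w\<close> is large enough (\<open>Idl_var_powers\<close>). If \<open>w = u v\<close>, where
  \<open>u\<close> and \<open>v\<close> have no variable in common, each exponent of \<open>w\<close> is one of \<open>u\<close> or one of
  \<open>v\<close>, so \<open>w \<in> Q\<^sub>j\<close> if and only if \<open>u \<in> Q\<^sub>j\<close> or \<open>v \<in> Q\<^sub>j\<close>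
  (\<open>add_mem_power_exponents_iff\<close>). Every monomial \<open>w\<close> factors uniquely into \<open>u \<in> K[x\<^sub>1, \<dots>, x\<^sub>r]\<close> and
  \<open>v \<in> K[x\<^sub>r\<^sub>+\<^sub>1, \<dots>, x\<^sub>n]\<close>. A monomial lies in a sum of monomial ideals only if it lies in one of the
  summands, so the condition on \<open>u\<close> in the definition of a piece says that \<open>\<tau>\<close> is the set of those
  \<open>j\<close> for which \<open>u \<notin> Q\<^sub>j\<close>. Hence \<open>w\<close> belongs to at most one piece; and to exactly one if \<open>w \<in> I\<close>,
  since then \<open>v \<in> Q\<^sub>j\<close> for all \<open>j\<close> with \<open>u \<notin> Q\<^sub>j\<close>.
\<close>

section \<open>Spaces spanned by monomials\<close>

definition exponents :: "nat set \<Rightarrow> (nat \<Rightarrow>\<^sub>0 nat) set" where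
  "exponents V = {m. Poly_Mapping.keys m \<subseteq> V}"

definition monomial_span :: "(nat \<Rightarrow>\<^sub>0 nat) set \<Rightarrow> 'k::field mpoly set" where
  "monomial_span E = {p. Poly_Mapping.keys p \<subseteq> E}"

lemma exponents_mono: "V \<subseteq> W \<Longrightarrow> exponents V \<subseteq> exponents W"
  by (auto simp: exponents_def)

lemma exponents_add: "x \<in> exponents V \<Longrightarrow> y \<in> exponents V \<Longrightarrow> x + y \<in> exponents V"
  using Poly_Mapping.keys_add[of x y] by (auto simp: exponents_def)

lemma polys_eq_monomial_span: "polys V = monomial_span (exponents V)"
  by (auto simp: polys_def monomial_span_def exponents_def)

lemma single_mem_monomial_span_iff:
  "(Poly_Mapping.single m 1 :: 'k::field mpoly) \<in> monomial_span E \<longleftrightarrow> m \<in> E"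
  by (simp add: monomial_span_def)

lemma monomial_span_mono: "E \<subseteq> F \<Longrightarrow> monomial_span E \<subseteq> monomial_span F"
  by (auto simp: monomial_span_def)

lemma lookup_scalar_mult: "Poly_Mapping.lookup (scalar_mult c p) m = c * Poly_Mapping.lookup p m"
  by (simp add: scalar_mult_def map.rep_eq when_def)

lemma subspace_monomial_span: "mpoly.subspace (monomial_span E)"
  unfolding mpoly.subspace_def
proof (intro conjI allI ballI)
  fix p q :: "'k::field mpoly" assume "p \<in> monomial_span E" "q \<in> monomial_span E"
  then show "p + q \<in> monomial_span E"
    using Poly_Mapping.keys_add[of p q] by (auto simp: monomial_span_def)
next
  fix c and p :: "'k::field mpoly" assume "p \<in> monomial_span E"
  then show "scalar_mult c p \<in> monomial_span E"
    by (auto simp: monomial_span_def in_keys_iff lookup_scalar_mult)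
qed (simp add: monomial_span_def)

lemma sum_single_lookup:
  "(\<Sum>m\<in>Poly_Mapping.keys p. Poly_Mapping.single m (Poly_Mapping.lookup p m)) = p"
  by (rule poly_mapping_eqI)
    (simp add: lookup_sum lookup_single when_def in_keys_iff)

lemma span_monomials:
  "mpoly.span ((\<lambda>m. Poly_Mapping.single m 1) ` E) = (monomial_span E :: 'k::field mpoly set)"
proof (rule mpoly.span_unique)
  fix T :: "'k mpoly set"
  assume T: "(\<lambda>m. Poly_Mapping.single m 1) ` E \<subseteq> T" "mpoly.subspace T"
  have "p \<in> T" if "p \<in> monomial_span E" for p
  proof -
    have "Poly_Mapping.single m (Poly_Mapping.lookup p m) \<in> T" if "m \<in> Poly_Mapping.keys p" for m
    proof -
      have "scalar_mult (Poly_Mapping.lookup p m) (Poly_Mapping.single m 1) \<in> T"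
        using that \<open>p \<in> monomial_span E\<close> T
        by (intro mpoly.subspace_scale) (auto simp: monomial_span_def)
      then show ?thesis by (simp add: scalar_mult_def)
    qed
    then have "(\<Sum>m\<in>Poly_Mapping.keys p. Poly_Mapping.single m (Poly_Mapping.lookup p m)) \<in> T"
      by (intro mpoly.subspace_sum T(2))
    then show ?thesis by (simp add: sum_single_lookup)
  qed
  then show "monomial_span E \<subseteq> T" by blast
qed (auto simp: single_mem_monomial_span_iff subspace_monomial_span)


section \<open>Partitions of monomials and direct sums\<close>

text \<open>The projection onto \<open>monomial_span E\<close> along the span of the other monomials.\<close>

definition monomial_part :: "(nat \<Rightarrow>\<^sub>0 nat) set \<Rightarrow> 'k::field mpoly \<Rightarrow> 'k mpoly" where
  "monomial_part E p =
     (\<Sum>m\<in>Poly_Mapping.keys p \<inter> E. Poly_Mapping.single m (Poly_Mapping.lookup p m))"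

lemma lookup_monomial_part:
  "Poly_Mapping.lookup (monomial_part E p) m = (if m \<in> E then Poly_Mapping.lookup p m else 0)"
  by (auto simp: monomial_part_def lookup_sum lookup_single when_def in_keys_iff)

lemma monomial_part_mem: "p \<in> monomial_span F \<Longrightarrow> monomial_part E p \<in> monomial_span (E \<inter> F)"
  by (auto simp: monomial_span_def in_keys_iff lookup_monomial_part split: if_splits)

lemma monomial_span_Un:
  "(monomial_span E + monomial_span F :: 'k::field mpoly set) = monomial_span (E \<union> F)"
proof
  show "monomial_span E + monomial_span F \<subseteq> (monomial_span (E \<union> F) :: 'k mpoly set)"
    using Poly_Mapping.keys_add by (fastforce simp: monomial_span_def set_plus_def)
  show "monomial_span (E \<union> F) \<subseteq> (monomial_span E + monomial_span F :: 'k mpoly set)"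
  proof
    fix p :: "'k mpoly"
    assume p: "p \<in> monomial_span (E \<union> F)"
    have "p = monomial_part E p + monomial_part (- E) p"
      by (rule poly_mapping_eqI) (simp add: lookup_add lookup_monomial_part)
    moreover have "monomial_part E p \<in> monomial_span E"
      using monomial_part_mem[OF p, of E] monomial_span_mono[of "E \<inter> (E \<union> F)" E] by blast
    moreover have "monomial_part (- E) p \<in> monomial_span F"
      using monomial_part_mem[OF p, of "- E"] monomial_span_mono[of "- E \<inter> (E \<union> F)" F] by blast
    ultimately show "p \<in> monomial_span E + monomial_span F"
      using set_plus_intro by metis
  qed
qed

text \<open>
  For single monomials, this says that a monomial in such a sum lies in one of the summands.
\<close>

lemma sum_monomial_span:
  assumes "finite J"
  shows "(\<Sum>j\<in>J. monomial_span (E j) :: 'k::field mpoly set) = monomial_span (\<Union>j\<in>J. E j)"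
  using assms
proof induction
  case empty
  show ?case by (auto simp: monomial_span_def set_zero)
qed (simp add: monomial_span_Un)

text \<open>
  In a sum of members of the spaces spanned by disjoint sets of monomials, the summand with index
  \<open>i\<close> is the part supported on the \<open>i\<close>th set. This gives the uniqueness of the summands, and it
  tells which summands to choose for a given sum.
\<close>

lemma monomial_part_sum:
  fixes f :: "'i \<Rightarrow> 'k::field mpoly"
  assumes disj: "disjoint_family_on E A"
    and f: "\<And>i. i \<in> A \<Longrightarrow> f i \<in> monomial_span (E i)" "\<And>i. i \<notin> A \<Longrightarrow> f i = 0"
    and fin: "finite {i. f i \<noteq> 0}"
    and i: "i \<in> A"
  shows "monomial_part (E i) (\<Sum>i | f i \<noteq> 0. f i) = f i"
proof (rule poly_mapping_eqI)
  fix m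
  show "Poly_Mapping.lookup (monomial_part (E i) (\<Sum>i | f i \<noteq> 0. f i)) m =
    Poly_Mapping.lookup (f i) m"
  proof (cases "m \<in> E i")
    case True
    have other: "Poly_Mapping.lookup (f j) m = 0" if "j \<noteq> i" for j
    proof (cases "j \<in> A")
      case True
      then have "m \<notin> E j"
        using disj i \<open>m \<in> E i\<close> that by (auto simp: disjoint_family_on_def)
      then show ?thesis
        using f(1)[of j] True by (auto simp: monomial_span_def in_keys_iff)
    qed (use f(2) in auto)
    have "(\<Sum>j | f j \<noteq> 0. Poly_Mapping.lookup (f j) m) =
        (\<Sum>j | f j \<noteq> 0. if j = i then Poly_Mapping.lookup (f i) m else 0)"
      by (intro sum.cong) (use other in auto)
    also have "\<dots> = Poly_Mapping.lookup (f i) m"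
      using fin by simp
    finally show ?thesis
      using True by (simp add: lookup_monomial_part lookup_sum)
  next
    case False
    then show ?thesis
      using f(1)[OF i] by (auto simp: lookup_monomial_part monomial_span_def in_keys_iff)
  qed
qed

lemma is_direct_sum_monomial_span:
  assumes disj: "disjoint_family_on E A"
  shows "is_direct_sum A (\<lambda>i. monomial_span (E i)) (monomial_span (\<Union>i\<in>A. E i) :: 'k::field mpoly set)"
  unfolding is_direct_sum_def
proof (intro conjI ballI)
  fix i assume "i \<in> A"
  then show "monomial_span (E i) \<subseteq> monomial_span (\<Union>i\<in>A. E i)"
    by (intro monomial_span_mono) auto
next
  fix w :: "'k mpoly"
  assume w: "w \<in> monomial_span (\<Union>i\<in>A. E i)"
  define f where "f i = (if i \<in> A then monomial_part (E i) w else 0)" for i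
  have f: "f i \<in> monomial_span (E i)" if "i \<in> A" for i
    using that by (auto simp: f_def monomial_span_def in_keys_iff lookup_monomial_part split: if_splits)
  have f0: "f i = 0" if "i \<notin> A" for i
    using that by (simp add: f_def)
  have fin: "finite {i. f i \<noteq> 0}"
  proof -
    \<comment> \<open>\<open>f i\<close> vanishes unless \<open>i\<close> is the index of the class of one of the finitely many
      monomials of \<open>w\<close>.\<close>
    obtain h where h: "m \<in> E (h m)" "h m \<in> A" if "m \<in> Poly_Mapping.keys w" for m
      using w unfolding monomial_span_def by (metis UN_E mem_Collect_eq subsetD)
    have "{i. f i \<noteq> 0} \<subseteq> h ` Poly_Mapping.keys w"
    proof
      fix i assume "i \<in> {i. f i \<noteq> 0}"
      then have "Poly_Mapping.keys (f i) \<noteq> {}" and i: "i \<in> A"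
        using f0 by auto
      then obtain m where m: "m \<in> Poly_Mapping.keys (f i)" by blast
      with i have "m \<in> E i" "m \<in> Poly_Mapping.keys w"
        by (auto simp: f_def in_keys_iff lookup_monomial_part split: if_splits)
      then show "i \<in> h ` Poly_Mapping.keys w"
        using h[of m] disj i by (auto simp: disjoint_family_on_def)
    qed
    then show ?thesis by (rule finite_subset) simp
  qed
  have "w = (\<Sum>i | f i \<noteq> 0. f i)"
  proof (rule poly_mapping_eqI)
    fix m
    show "Poly_Mapping.lookup w m = Poly_Mapping.lookup (\<Sum>i | f i \<noteq> 0. f i) m"
    proof (cases "\<exists>i\<in>A. m \<in> E i")
      case True
      then obtain i where i: "i \<in> A" "m \<in> E i" by blast
      then have "Poly_Mapping.lookup (monomial_part (E i) w) m =
          Poly_Mapping.lookup (monomial_part (E i) (\<Sum>i | f i \<noteq> 0. f i)) m"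
        using monomial_part_sum[OF disj f f0 fin i(1)] by (simp add: f_def)
      then show ?thesis using i by (simp add: lookup_monomial_part)
    next
      case False
      then have "Poly_Mapping.lookup w m = 0" "Poly_Mapping.lookup (f i) m = 0" for i
        using w by (auto simp: monomial_span_def in_keys_iff f_def lookup_monomial_part)
      then show ?thesis by (simp add: lookup_sum)
    qed
  qed
  moreover have "g = f" if g: "\<forall>i\<in>A. g i \<in> monomial_span (E i)" "\<forall>i. i \<notin> A \<longrightarrow> g i = 0"
    "finite {i. g i \<noteq> 0}" "w = (\<Sum>i | g i \<noteq> 0. g i)" for g
    using monomial_part_sum[OF disj, of g] g by (auto simp: f_def fun_eq_iff)
  ultimately show "\<exists>!f. (\<forall>i\<in>A. f i \<in> monomial_span (E i)) \<and> (\<forall>i. i \<notin> A \<longrightarrow> f i = 0) \<and>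
      finite {i. f i \<noteq> 0} \<and> w = (\<Sum>i | f i \<noteq> 0. f i)"
    using f f0 fin by (intro ex1I[of _ f]) auto
qed (simp_all add: subspace_monomial_span)

text \<open>
  The exponent vectors in \<open>E\<close> are partitioned by degree, that is, by their restriction to \<open>{1..n}\<close>.
  The classes have at most one member, and those of degrees with a negative entry are empty.
\<close>

lemma graded_subspace_monomial_span:
  assumes E: "E \<subseteq> exponents {1..n}"
  shows "graded_subspace n (monomial_span E :: 'k::field mpoly set)"
proof -
  let ?A = "{1..n} \<rightarrow>\<^sub>E (UNIV :: int set)"
  define F where "F a = {m \<in> E. \<forall>i\<in>{1..n}. int (Poly_Mapping.lookup m i) = a i}" for a
  have component: "(monomial_span E :: 'k mpoly set) \<inter> graded_component n a = monomial_span (F a)" for a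
    using E by (auto simp: F_def graded_component_def monomial_span_def polys_def exponents_def)
  have "a = b" if "m \<in> F a" "m \<in> F b" "a \<in> ?A" "b \<in> ?A" for a b m
    using that(3,4) by (rule PiE_ext) (use that(1,2) in \<open>auto simp: F_def\<close>)
  then have "disjoint_family_on F ?A"
    by (auto simp: disjoint_family_on_def)
  moreover have "m \<in> (\<Union>a\<in>?A. F a)" if "m \<in> E" for m
    using that by (intro UN_I[of "\<lambda>i\<in>{1..n}. int (Poly_Mapping.lookup m i)"]) (auto simp: F_def)
  then have "(\<Union>a\<in>?A. F a) = E" by (auto simp: F_def)
  ultimately show ?thesis
    using is_direct_sum_monomial_span[of F ?A, where 'k = 'k]
    by (simp add: graded_subspace_def component)
qed


section \<open>Ideals generated by powers of variables\<close>

definition power_exponents :: "nat \<Rightarrow> nat set \<Rightarrow> (nat \<Rightarrow> nat) \<Rightarrow> (nat \<Rightarrow>\<^sub>0 nat) set" where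
  "power_exponents n V a = {m \<in> exponents {1..n}. \<exists>i\<in>V. a i \<le> Poly_Mapping.lookup m i}"

text \<open>
  For disjoint sets of variables each exponent of \<open>x + y\<close> is an exponent of \<open>x\<close> or of \<open>y\<close>, and
  membership is a condition on a single exponent. For the monomials of other ideals this fails, as
  the ideal \<open>(x\<^sub>1 x\<^sub>2)\<close> shows.
\<close>

lemma add_mem_power_exponents_iff:
  assumes x: "x \<in> exponents X" "X \<subseteq> {1..n}" and y: "y \<in> exponents Y" "Y \<subseteq> {1..n}"
    and "X \<inter> Y = {}"
  shows "x + y \<in> power_exponents n V a \<longleftrightarrow> x \<in> power_exponents n V a \<or> y \<in> power_exponents n V a"
proof -
  have "Poly_Mapping.lookup x i = 0 \<or> Poly_Mapping.lookup y i = 0" for i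
    using assms unfolding exponents_def
    by (metis (lifting) IntI empty_iff in_keys_iff mem_Collect_eq subsetD)
  then have "a i \<le> Poly_Mapping.lookup (x + y) i \<longleftrightarrow>
      a i \<le> Poly_Mapping.lookup x i \<or> a i \<le> Poly_Mapping.lookup y i" for i
    by (metis add.right_neutral add_0 le_add1 le_add2 le_trans lookup_add)
  moreover have "x \<in> exponents {1..n}" "y \<in> exponents {1..n}"
    using x(1) exponents_mono[OF x(2)] y(1) exponents_mono[OF y(2)] by auto
  moreover from this have "x + y \<in> exponents {1..n}" by (rule exponents_add)
  ultimately show ?thesis by (auto simp: power_exponents_def)
qed

lemma var_power: "(var i :: 'k::field mpoly) ^ k = Poly_Mapping.single (Poly_Mapping.single i k) 1"
  by (induction k) (simp_all add: var_def mult_single flip: single_add)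

lemma ideal_power_exponents:
  "ideal (monomial_span (power_exponents n V a)) (poly_ring {1..n} :: 'k::field mpoly ring)"
proof (rule idealI)
  let ?R = "poly_ring {1..n} :: 'k mpoly ring"
  let ?M = "monomial_span (power_exponents n V a) :: 'k mpoly set"
  interpret R: cring ?R by (rule cring_poly_ring)
  show "ring ?R" by (rule R.ring_axioms)
  have M: "?M \<subseteq> polys {1..n}"
    by (auto simp: polys_eq_monomial_span monomial_span_def power_exponents_def)
  have minus: "\<ominus>\<^bsub>?R\<^esub> p = - p" if "p \<in> polys {1..n}" for p
    using that by (intro R.minus_equality) (auto simp: poly_ring_def polys_minus)
  show "subgroup ?M (add_monoid ?R)"
  proof (rule group.subgroupI[OF R.a_group])
    show "?M \<subseteq> carrier (add_monoid ?R)" using M by (simp add: poly_ring_def)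
    have "0 \<in> ?M" by (simp add: monomial_span_def)
    then show "?M \<noteq> {}" by blast
    fix p q assume pq: "p \<in> ?M" "q \<in> ?M"
    show "inv\<^bsub>add_monoid ?R\<^esub> p \<in> ?M"
      using pq M minus[of p] mpoly.subspace_neg[OF subspace_monomial_span, of p]
      unfolding a_inv_def by auto
    show "p \<otimes>\<^bsub>add_monoid ?R\<^esub> q \<in> ?M"
      using pq mpoly.subspace_add[OF subspace_monomial_span] by (auto simp: poly_ring_def)
  qed
  have mult: "q * p \<in> ?M" if p: "p \<in> ?M" and q: "q \<in> polys {1..n}" for p q
  proof -
    have "x + y \<in> power_exponents n V a"
      if x: "x \<in> Poly_Mapping.keys q" and y: "y \<in> Poly_Mapping.keys p" for x y
    proof -
      have "x \<in> exponents {1..n}" and y': "y \<in> power_exponents n V a"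
        using x y p q by (auto simp: monomial_span_def polys_eq_monomial_span)
      then have "x + y \<in> exponents {1..n}"
        by (intro exponents_add) (auto simp: power_exponents_def)
      then show ?thesis
        using y' by (auto simp: power_exponents_def lookup_add intro: trans_le_add2)
    qed
    then show ?thesis
      using keys_mult[of q p] by (auto simp: monomial_span_def)
  qed
  fix p q assume "p \<in> ?M" "q \<in> carrier ?R"
  then show "q \<otimes>\<^bsub>?R\<^esub> p \<in> ?M" "p \<otimes>\<^bsub>?R\<^esub> q \<in> ?M"
    using mult[of p q] by (simp_all add: poly_ring_def mult.commute)
qed

text \<open>
  A monomial in which the exponent of \<open>x\<^sub>i\<close> is at least \<open>a i\<close> is a multiple of the generator
  \<open>x\<^sub>i ^ a i\<close>; conversely, the span of all such monomials is already an ideal.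
\<close>

lemma Idl_var_powers:
  assumes "V \<subseteq> {1..n}"
  shows "Idl\<^bsub>poly_ring {1..n}\<^esub> ((\<lambda>i. var i ^ a i) ` V) =
    (monomial_span (power_exponents n V a) :: 'k::field mpoly set)" (is "?I = ?M")
proof
  let ?R = "poly_ring {1..n} :: 'k mpoly ring"
  let ?G = "(\<lambda>i. var i ^ a i) ` V :: 'k mpoly set"
  interpret R: cring ?R by (rule cring_poly_ring)
  have G: "?G \<subseteq> ?M"
  proof (rule image_subsetI)
    fix i assume "i \<in> V"
    then have "Poly_Mapping.single i (a i) \<in> power_exponents n V a"
      using assms by (auto simp: power_exponents_def exponents_def intro!: bexI[of _ i])
    then show "var i ^ a i \<in> ?M"
      by (simp add: var_power single_mem_monomial_span_iff)
  qed
  then show "?I \<subseteq> ?M" by (intro R.genideal_minimal ideal_power_exponents)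
  have "?G \<subseteq> carrier ?R"
    using G by (auto simp: poly_ring_def polys_eq_monomial_span monomial_span_def power_exponents_def)
  note G_in_I = R.genideal_self[OF this]
  interpret I: ideal ?I ?R
    using \<open>?G \<subseteq> carrier ?R\<close> by (rule R.genideal_ideal)
  have single_mem: "Poly_Mapping.single m c \<in> ?I" if m: "m \<in> power_exponents n V a" for m c
  proof -
    obtain i where i: "i \<in> V" "a i \<le> Poly_Mapping.lookup m i"
      using m by (auto simp: power_exponents_def)
    define m' where "m' = m - Poly_Mapping.single i (a i)"
    have m'_eq: "m = m' + Poly_Mapping.single i (a i)"
      using i by (intro poly_mapping_eqI) (auto simp: m'_def lookup_add lookup_minus lookup_single when_def)
    have "Poly_Mapping.keys m' \<subseteq> Poly_Mapping.keys m"
      by (auto simp: m'_def in_keys_iff lookup_minus)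
    then have "Poly_Mapping.single m' c \<in> carrier ?R"
      using m by (auto simp: poly_ring_def polys_def power_exponents_def exponents_def)
    moreover have "var i ^ a i \<in> ?I" using G_in_I i by blast
    ultimately have "Poly_Mapping.single m' c \<otimes>\<^bsub>?R\<^esub> (var i ^ a i) \<in> ?I"
      by (rule I.I_l_closed[rotated])
    then show ?thesis
      by (simp add: poly_ring_def var_power mult_single m'_eq)
  qed
  show "?M \<subseteq> ?I"
  proof
    fix p assume "p \<in> ?M"
    then have keys: "Poly_Mapping.keys p \<subseteq> power_exponents n V a"
      by (simp add: monomial_span_def)
    have "(\<Sum>m\<in>S. Poly_Mapping.single m (Poly_Mapping.lookup p m)) \<in> ?I"
      if "finite S" "S \<subseteq> Poly_Mapping.keys p" for S
      using that
    proof (induction S)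
      case empty
      show ?case using I.zero_closed by (simp add: poly_ring_def)
    next
      case (insert m S)
      then show ?case
        using I.a_closed[of "Poly_Mapping.single m (Poly_Mapping.lookup p m)"
            "\<Sum>m\<in>S. Poly_Mapping.single m (Poly_Mapping.lookup p m)"] single_mem[of m] keys
        by (auto simp: poly_ring_def)
    qed
    from this[of "Poly_Mapping.keys p"] show "p \<in> ?I" by (simp add: sum_single_lookup)
  qed
qed


section \<open>The decomposition\<close>

lemma exponents_add_split:
  assumes "m \<in> exponents (X \<union> Y)" "X \<inter> Y = {}"
  obtains x y where "x \<in> exponents X" "y \<in> exponents Y" "m = x + y"
proof -
  define x where "x = (\<Sum>i\<in>Poly_Mapping.keys m \<inter> X. Poly_Mapping.single i (Poly_Mapping.lookup m i))"
  define y where "y = (\<Sum>i\<in>Poly_Mapping.keys m \<inter> Y. Poly_Mapping.single i (Poly_Mapping.lookup m i))"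
  have keys: "(Poly_Mapping.keys m \<inter> X) \<union> (Poly_Mapping.keys m \<inter> Y) = Poly_Mapping.keys m"
    using assms(1) by (auto simp: exponents_def)
  have "m = (\<Sum>i\<in>(Poly_Mapping.keys m \<inter> X) \<union> (Poly_Mapping.keys m \<inter> Y).
      Poly_Mapping.single i (Poly_Mapping.lookup m i))"
    unfolding keys by (simp add: sum_single_lookup)
  also have "\<dots> = x + y"
    unfolding x_def y_def using assms(2) by (intro sum.union_disjoint) auto
  finally have "m = x + y" .
  moreover have "x \<in> exponents X" "y \<in> exponents Y"
    by (auto simp: x_def y_def exponents_def in_keys_iff lookup_sum lookup_single when_def
        split: if_splits)
  ultimately show thesis by (rule that[rotated 2])
qed

lemma exponents_add_unique:
  assumes "x \<in> exponents X" "x' \<in> exponents X" "y \<in> exponents Y" "y' \<in> exponents Y"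
    and "X \<inter> Y = {}" and "x + y = x' + y'"
  shows "x = x'"
proof (rule poly_mapping_eqI)
  fix i
  have "Poly_Mapping.lookup x i + Poly_Mapping.lookup y i =
      Poly_Mapping.lookup x' i + Poly_Mapping.lookup y' i"
    using assms(6) by (metis lookup_add)
  moreover have "i \<notin> X \<or> i \<notin> Y" using assms(5) by blast
  ultimately show "Poly_Mapping.lookup x i = Poly_Mapping.lookup x' i"
    using assms(1-4) unfolding exponents_def in_keys_iff
    by (metis add_cancel_right_right in_keys_iff mem_Collect_eq subsetD add.right_neutral)
qed

text \<open>
  With \<open>D j\<close> the exponent vectors of the monomials in \<open>Q\<^sub>j\<close>, the two conditions on the factor \<open>u\<close>
  in \<open>piece\<close> are combined into one equation that determines \<open>\<tau>\<close> from \<open>u\<close>.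
\<close>

definition piece_exponents ::
  "nat \<Rightarrow> nat \<Rightarrow> nat \<Rightarrow> (nat \<Rightarrow> (nat \<Rightarrow>\<^sub>0 nat) set) \<Rightarrow> nat set \<Rightarrow> (nat \<Rightarrow>\<^sub>0 nat) set" where
  "piece_exponents n r s D \<tau> = {x + y | x y. x \<in> exponents {1..r} \<and> y \<in> exponents {r+1..n} \<and>
     \<tau> = {j\<in>{1..s}. x \<notin> D j} \<and> (\<forall>j\<in>\<tau>. y \<in> D j)}"

lemma piece_eq_monomial_span:
  fixes Q :: "nat \<Rightarrow> 'k::field mpoly set"
  assumes Q: "\<And>j. j \<in> {1..s} \<Longrightarrow> Q j = monomial_span (D j)"
    and \<tau>: "\<tau> \<subseteq> {1..s}" and r: "r \<le> n"
  shows "piece n r s Q \<tau> = monomial_span (piece_exponents n r s D \<tau>)"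
proof -
  have "sum Q \<tau> = (\<Sum>j\<in>\<tau>. monomial_span (D j))"
    using Q \<tau> by (intro sum.cong) auto
  also have "\<dots> = monomial_span (\<Union>j\<in>\<tau>. D j)"
    using \<tau> by (intro sum_monomial_span) (rule finite_subset, auto)
  finally have sum_Q: "sum Q \<tau> = monomial_span (\<Union>j\<in>\<tau>. D j)" .
  have polys: "(Poly_Mapping.single m 1 :: 'k mpoly) \<in> polys V \<longleftrightarrow> m \<in> exponents V" for m V
    by (simp add: polys_eq_monomial_span single_mem_monomial_span_iff)
  have Inter: "(Poly_Mapping.single m 1 :: 'k mpoly) \<in> ideal_Inter n Q J \<longleftrightarrow>
      m \<in> exponents {1..n} \<and> (\<forall>j\<in>J. m \<in> D j)" if "J \<subseteq> {1..s}" for m J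
  proof -
    have "(Poly_Mapping.single m 1 :: 'k mpoly) \<in> Q j \<longleftrightarrow> m \<in> D j" if "j \<in> J" for j
      using Q[of j] that \<open>J \<subseteq> {1..s}\<close> by (auto simp: single_mem_monomial_span_iff)
    then show ?thesis by (auto simp: ideal_Inter_def polys)
  qed
  have n: "exponents {1..r} \<subseteq> exponents {1..n}" "exponents {r+1..n} \<subseteq> exponents {1..n}"
    using r by (auto intro!: exponents_mono)
  define P where "P x y \<longleftrightarrow> x \<in> exponents {1..r} \<and> y \<in> exponents {r+1..n} \<and>
      \<tau> = {j\<in>{1..s}. x \<notin> D j} \<and> (\<forall>j\<in>\<tau>. y \<in> D j)" for x y
  have P: "P x y \<longleftrightarrow>
      (Poly_Mapping.single x 1 :: 'k mpoly) \<in> polys {1..r} \<and>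
      (Poly_Mapping.single x 1 :: 'k mpoly) \<in> ideal_Inter n Q ({1..s} - \<tau>) - sum Q \<tau> \<and>
      (Poly_Mapping.single y 1 :: 'k mpoly) \<in> polys {r+1..n} \<and>
      (Poly_Mapping.single y 1 :: 'k mpoly) \<in> ideal_Inter n Q \<tau>" for x y
    using \<tau> n by (auto simp: P_def polys Inter sum_Q single_mem_monomial_span_iff)
  have "{u * v | u v. u \<in> (monomials :: 'k mpoly set) \<and> v \<in> monomials \<and>
      u \<in> polys {1..r} \<and> u \<in> ideal_Inter n Q ({1..s} - \<tau>) - sum Q \<tau> \<and>
      v \<in> polys {r+1..n} \<and> v \<in> ideal_Inter n Q \<tau>} =
      {Poly_Mapping.single x 1 * Poly_Mapping.single y 1 | x y. P x y}"
    unfolding P monomials_def by blast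
  also have "\<dots> = (\<lambda>m. Poly_Mapping.single m 1) ` piece_exponents n r s D \<tau>"
    by (auto simp: piece_exponents_def P_def mult_single)
  finally show ?thesis
    by (simp add: piece_def span_monomials)
qed

text \<open>
  The factor \<open>u\<close> is determined by the monomial \<open>u v\<close>, and \<open>\<tau>\<close> by \<open>u\<close>.
\<close>

lemma disjoint_piece_exponents: "disjoint_family_on (piece_exponents n r s D) A"
  unfolding disjoint_family_on_def
proof (intro ballI impI, rule ccontr)
  fix \<sigma> \<tau> :: "nat set" assume ne: "\<sigma> \<noteq> \<tau>"
  assume "piece_exponents n r s D \<sigma> \<inter> piece_exponents n r s D \<tau> \<noteq> {}"
  then obtain x y x' y' where xy: "x \<in> exponents {1..r}" "x' \<in> exponents {1..r}"
      "y \<in> exponents {r+1..n}" "y' \<in> exponents {r+1..n}" "x + y = x' + y'"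
    and "\<sigma> = {j\<in>{1..s}. x \<notin> D j}" "\<tau> = {j\<in>{1..s}. x' \<notin> D j}"
    by (auto simp: piece_exponents_def)
  moreover have "{1..r} \<inter> {r+1..n} = {}" by auto
  ultimately show False
    using ne exponents_add_unique[of x "{1..r}" x' y "{r+1..n}" y'] by auto
qed

text \<open>
  A monomial \<open>u v\<close> lies in every \<open>Q\<^sub>j\<close> if and only if \<open>v\<close> lies in those \<open>Q\<^sub>j\<close> that do not contain
  \<open>u\<close>; so it belongs to the piece of \<open>\<tau> = {j. u \<notin> Q\<^sub>j}\<close>.
\<close>

lemma Union_piece_exponents:
  assumes D: "\<And>j. j \<in> {1..s} \<Longrightarrow> D j = power_exponents n (V j) (a j)" and r: "r \<le> n"
  shows "(\<Union>\<tau>\<in>Pow {1..s}. piece_exponents n r s D \<tau>) = exponents {1..n} \<inter> (\<Inter>j\<in>{1..s}. D j)"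
proof -
  have disj: "{1..r} \<inter> {r+1..n} = {}" and sub: "{1..r} \<subseteq> {1..n}" "{r+1..n} \<subseteq> {1..n}"
    and Un: "{1..r} \<union> {r+1..n} = {1..n}"
    using r by auto
  have add: "x + y \<in> D j \<longleftrightarrow> x \<in> D j \<or> y \<in> D j"
    if "x \<in> exponents {1..r}" "y \<in> exponents {r+1..n}" "j \<in> {1..s}" for x y j
    using add_mem_power_exponents_iff[OF that(1) sub(1) that(2) sub(2) disj] D[OF that(3)] by simp
  show ?thesis
  proof (intro equalityI subsetI)
    fix m assume "m \<in> (\<Union>\<tau>\<in>Pow {1..s}. piece_exponents n r s D \<tau>)"
    then obtain x y where xy: "x \<in> exponents {1..r}" "y \<in> exponents {r+1..n}" "m = x + y"
        "\<forall>j\<in>{1..s}. x \<notin> D j \<longrightarrow> y \<in> D j"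
      by (auto simp: piece_exponents_def)
    then have "m \<in> exponents {1..n}"
      using exponents_mono[OF sub(1)] exponents_mono[OF sub(2)] exponents_add by blast
    then show "m \<in> exponents {1..n} \<inter> (\<Inter>j\<in>{1..s}. D j)"
      using xy add by auto
  next
    fix m assume m: "m \<in> exponents {1..n} \<inter> (\<Inter>j\<in>{1..s}. D j)"
    then obtain x y where xy: "x \<in> exponents {1..r}" "y \<in> exponents {r+1..n}" "m = x + y"
      using exponents_add_split[of m "{1..r}" "{r+1..n}"] disj Un by auto
    then have "\<forall>j\<in>{1..s}. x \<notin> D j \<longrightarrow> y \<in> D j" using m add by auto
    then have "m \<in> piece_exponents n r s D {j\<in>{1..s}. x \<notin> D j}"
      unfolding piece_exponents_def using xy by blast
    then show "m \<in> (\<Union>\<tau>\<in>Pow {1..s}. piece_exponents n r s D \<tau>)"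
      by (rule UN_I[rotated]) auto
  qed
qed

theorem proposition2p1:
  fixes I :: "'k::field mpoly set" and Q :: "nat \<Rightarrow> 'k mpoly set" and n r s :: nat
  assumes "monomial_ideal n I"
    and "irredundant_irreducible_presentation n I s Q"
    and "r \<le> n"
  shows "(\<forall>\<tau>\<in>Pow {1..s}. graded_subspace n (piece n r s Q \<tau>) \<and> piece n r s Q \<tau> \<subseteq> I) \<and>
    is_direct_sum (Pow {1..s}) (piece n r s Q) I"
proof -
  have "\<forall>j\<in>{1..s}. irreducible_monomial_ideal n (Q j)" and I: "I = ideal_Inter n Q {1..s}"
    using assms(2) by (auto simp: irredundant_irreducible_presentation_def)
  then have "\<forall>j\<in>{1..s}. \<exists>V a. Q j = monomial_span (power_exponents n V a)"
    unfolding irreducible_monomial_ideal_def using Idl_var_powers by metis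
  then obtain V a where "\<forall>j\<in>{1..s}. Q j = monomial_span (power_exponents n (V j) (a j))"
    by metis
  then obtain D where Q: "\<And>j. j \<in> {1..s} \<Longrightarrow> Q j = monomial_span (D j)"
    and D: "\<And>j. D j = power_exponents n (V j) (a j)"
    by fastforce
  let ?E = "piece_exponents n r s D"
  have Un: "(\<Union>\<tau>\<in>Pow {1..s}. ?E \<tau>) = exponents {1..n} \<inter> (\<Inter>j\<in>{1..s}. D j)"
    using D assms(3) by (rule Union_piece_exponents)
  also have "monomial_span \<dots> = I"
    using Q by (auto simp: I ideal_Inter_def polys_eq_monomial_span monomial_span_def)
  finally have I_eq: "I = monomial_span (\<Union>\<tau>\<in>Pow {1..s}. ?E \<tau>)" ..
  have piece: "piece n r s Q \<tau> = monomial_span (?E \<tau>)" if "\<tau> \<in> Pow {1..s}" for \<tau>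
    using Q that assms(3) by (intro piece_eq_monomial_span) auto
  have direct: "is_direct_sum (Pow {1..s}) (\<lambda>\<tau>. monomial_span (?E \<tau>)) I"
    unfolding I_eq by (rule is_direct_sum_monomial_span[OF disjoint_piece_exponents])
  have "graded_subspace n (piece n r s Q \<tau>) \<and> piece n r s Q \<tau> \<subseteq> I" if "\<tau> \<in> Pow {1..s}" for \<tau>
  proof
    have "?E \<tau> \<subseteq> exponents {1..n}" using Un that by blast
    then show "graded_subspace n (piece n r s Q \<tau>)"
      by (simp add: piece[OF that] graded_subspace_monomial_span)
    show "piece n r s Q \<tau> \<subseteq> I"
      using direct that by (simp add: is_direct_sum_def piece)
  qed
  moreover have "is_direct_sum (Pow {1..s}) (piece n r s Q) I"
    using direct by (simp add: is_direct_sum_def piece del: Pow_iff cong: ball_cong)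
  ultimately show ?thesis by blast
qed

end
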